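(* Let $n\ge 2$, let $K$ be a field, and let $L$ be the free Lie $K$-algebra with basis $\{a_1,\dots,a_n\}$. If the Diophantine problem in the field $K$ is undecidable, then the Diophantine problem in the Lie algebra $L$ is undecidable.
   Context: The Diophantine problem for an algebraic structure $\mathcal M$ asks for an algorithm which, given a finite system of equations (equalities of terms in the language of $\mathcal M$ with variables and constants from a fixed computable substructure of $\mathcal M$), decides whether the system has a solution in $\mathcal M$. For $L$ the equations are equalities of Lie-algebra terms built with $+$, scalar multiplication and the Lie product $[\cdot,\cdot]$. *)

theory Defs
  imports Complex_Main "HOL-Library.Nat_Bijection"
begin

section \<open>Computability\<close>

text \<open>Programs for partial recursive functions, with their standard partial semantics:
  \<open>rec_eval p xs y\<close> means that \<open>p\<close> halts on the arguments \<open>xs\<close> with value \<open>y\<close>.\<close>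

datatype recf = Zero | Succ | Proj nat | Comp recf "recf list" | PrimRec recf recf | Mu recf

inductive rec_eval :: "recf \<Rightarrow> nat list \<Rightarrow> nat \<Rightarrow> bool" where
  Zero: "rec_eval Zero xs 0"
| Succ: "rec_eval Succ [x] (Suc x)"
| Proj: "i < length xs \<Longrightarrow> rec_eval (Proj i) xs (xs ! i)"
| Comp: "list_all2 (\<lambda>g y. rec_eval g xs y) gs ys \<Longrightarrow> rec_eval f ys z \<Longrightarrow> rec_eval (Comp f gs) xs z"
| PrimRec_0: "rec_eval f xs y \<Longrightarrow> rec_eval (PrimRec f g) (0 # xs) y"
| PrimRec_Suc: "rec_eval (PrimRec f g) (x # xs) y \<Longrightarrow> rec_eval g (x # y # xs) z
    \<Longrightarrow> rec_eval (PrimRec f g) (Suc x # xs) z"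
| Mu: "rec_eval f (y # xs) 0 \<Longrightarrow> (\<And>z. z < y \<Longrightarrow> \<exists>v. rec_eval f (z # xs) (Suc v))
    \<Longrightarrow> rec_eval (Mu f) xs y"

lemma rec_eval_deterministic:
  "rec_eval p xs y \<Longrightarrow> rec_eval p xs y' \<Longrightarrow> y = y'"
proof (induction arbitrary: y' rule: rec_eval.induct)
  case (Zero xs)
  then show ?case by (auto elim: rec_eval.cases)
next
  case (Succ x)
  then show ?case by (auto elim: rec_eval.cases)
next
  case (Proj i xs)
  from Proj.prems show ?case by (auto elim: rec_eval.cases)
next
  case (Comp xs gs ys f z)
  from Comp.prems obtain ys' where ys': "list_all2 (\<lambda>g y. rec_eval g xs y) gs ys'"
      "rec_eval f ys' y'"
    by (auto elim: rec_eval.cases)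
  have "ys = ys'"
    using Comp.IH(1) ys'(1) by (auto simp: list_all2_conv_all_nth intro: nth_equalityI)
  then show ?case using Comp.IH(2) ys'(2) by simp
next
  case (PrimRec_0 f xs y g)
  from PrimRec_0.prems have "rec_eval f xs y'" by (auto elim: rec_eval.cases)
  then show ?case by (rule PrimRec_0.IH)
next
  case (PrimRec_Suc f g x xs y z)
  from PrimRec_Suc.prems obtain v where "rec_eval (PrimRec f g) (x # xs) v"
      "rec_eval g (x # v # xs) y'"
    by (auto elim: rec_eval.cases)
  then show ?case using PrimRec_Suc.IH by metis
next
  case (Mu f y xs)
  from Mu.prems have 1: "rec_eval f (y' # xs) 0"
    and 2: "\<And>z. z < y' \<Longrightarrow> \<exists>v. rec_eval f (z # xs) (Suc v)"
    by (auto elim: rec_eval.cases)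
  show ?case
    using 1 2[of y] Mu.IH(1) Mu.IH(2)[of y'] by (metis linorder_neqE_nat nat.distinct(1))
qed

definition computable1 :: "(nat \<Rightarrow> nat) \<Rightarrow> bool" where
  "computable1 f \<longleftrightarrow> (\<exists>p. \<forall>x. rec_eval p [x] (f x))"

definition computable2 :: "(nat \<Rightarrow> nat \<Rightarrow> nat) \<Rightarrow> bool" where
  "computable2 f \<longleftrightarrow> (\<exists>p. \<forall>x y. rec_eval p [x, y] (f x y))"

definition decidable :: "nat set \<Rightarrow> bool" where
  "decidable A \<longleftrightarrow> computable1 (\<lambda>x. if x \<in> A then 1 else 0)"

section \<open>Computable substructures\<close>

text \<open>A countable substructure is presented by a numbering, i.e. a surjection \<open>\<nu>\<close> from \<open>nat\<close> onto
  it. Numberings need not be injective, but equality of the numbered elements must be decidable.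
  An operation computed on indices automatically leaves the range invariant.\<close>

definition decidable_equality :: "(nat \<Rightarrow> 'a) \<Rightarrow> bool" where
  "decidable_equality \<nu> \<longleftrightarrow> computable2 (\<lambda>i j. if \<nu> i = \<nu> j then 1 else 0)"

definition computable_op1 :: "(nat \<Rightarrow> 'a) \<Rightarrow> (nat \<Rightarrow> 'b) \<Rightarrow> ('a \<Rightarrow> 'b) \<Rightarrow> bool" where
  "computable_op1 \<nu> \<mu> h \<longleftrightarrow> (\<exists>f. computable1 f \<and> (\<forall>i. \<mu> (f i) = h (\<nu> i)))"

definition computable_op2 ::
  "(nat \<Rightarrow> 'a) \<Rightarrow> (nat \<Rightarrow> 'b) \<Rightarrow> (nat \<Rightarrow> 'c) \<Rightarrow> ('a \<Rightarrow> 'b \<Rightarrow> 'c) \<Rightarrow> bool" where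
  "computable_op2 \<nu> \<mu> \<rho> h \<longleftrightarrow> (\<exists>f. computable2 f \<and> (\<forall>i j. \<rho> (f i j) = h (\<nu> i) (\<mu> j)))"

definition computable_subring :: "(nat \<Rightarrow> 'k::field) \<Rightarrow> bool" where
  "computable_subring \<kappa> \<longleftrightarrow> decidable_equality \<kappa> \<and> 0 \<in> range \<kappa> \<and> 1 \<in> range \<kappa> \<and>
     computable_op2 \<kappa> \<kappa> \<kappa> (+) \<and> computable_op1 \<kappa> \<kappa> uminus \<and> computable_op2 \<kappa> \<kappa> \<kappa> (*)"

definition computable_lie_subalgebra ::
  "('k::field \<Rightarrow> 'l::ab_group_add \<Rightarrow> 'l) \<Rightarrow> ('l \<Rightarrow> 'l \<Rightarrow> 'l) \<Rightarrow> (nat \<Rightarrow> 'k) \<Rightarrow> (nat \<Rightarrow> 'l) \<Rightarrow> bool" where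
  "computable_lie_subalgebra scale bracket \<kappa> \<mu> \<longleftrightarrow> decidable_equality \<mu> \<and> 0 \<in> range \<mu> \<and>
     computable_op2 \<mu> \<mu> \<mu> (+) \<and> computable_op2 \<kappa> \<mu> \<mu> scale \<and> computable_op2 \<mu> \<mu> \<mu> bracket"

section \<open>Lie algebras and free Lie algebras\<close>

locale lie_algebra = vector_space scale
  for scale :: "'k::field \<Rightarrow> 'l::ab_group_add \<Rightarrow> 'l" +
  fixes bracket :: "'l \<Rightarrow> 'l \<Rightarrow> 'l"
  assumes bracket_add_left: "bracket (x + y) z = bracket x z + bracket y z"
    and bracket_add_right: "bracket x (y + z) = bracket x y + bracket x z"
    and bracket_scale_left: "bracket (scale c x) y = scale c (bracket x y)"
    and bracket_scale_right: "bracket x (scale c y) = scale c (bracket x y)"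
    and bracket_self: "bracket x x = 0"
    and jacobi: "bracket x (bracket y z) + bracket y (bracket z x) + bracket z (bracket x y) = 0"

text \<open>Formal Lie expressions in generators and the least congruence forced by the axioms of
  Lie algebras. The free Lie algebra is the algebra of expressions modulo this congruence;
  \<open>free_lie_algebra\<close> says that evaluation at the family \<open>a\<close> induces an isomorphism from it onto
  the given Lie algebra.\<close>

datatype ('k, gens: 'i) lie_expr =
    Gen 'i
  | Null
  | Plus "('k, 'i) lie_expr" "('k, 'i) lie_expr"
  | Smult 'k "('k, 'i) lie_expr"
  | Brk "('k, 'i) lie_expr" "('k, 'i) lie_expr"

inductive lie_eq :: "('k::field, 'i) lie_expr \<Rightarrow> ('k, 'i) lie_expr \<Rightarrow> bool" where
  refl: "lie_eq s s"
| sym: "lie_eq s t \<Longrightarrow> lie_eq t s"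
| trans: "lie_eq s t \<Longrightarrow> lie_eq t u \<Longrightarrow> lie_eq s u"
| Plus_cong: "lie_eq s s' \<Longrightarrow> lie_eq t t' \<Longrightarrow> lie_eq (Plus s t) (Plus s' t')"
| Smult_cong: "lie_eq s s' \<Longrightarrow> lie_eq (Smult c s) (Smult c s')"
| Brk_cong: "lie_eq s s' \<Longrightarrow> lie_eq t t' \<Longrightarrow> lie_eq (Brk s t) (Brk s' t')"
| Plus_assoc: "lie_eq (Plus (Plus s t) u) (Plus s (Plus t u))"
| Plus_commute: "lie_eq (Plus s t) (Plus t s)"
| Plus_Null: "lie_eq (Plus s Null) s"
| Plus_minus: "lie_eq (Plus s (Smult (- 1) s)) Null"
| Smult_Plus: "lie_eq (Smult c (Plus s t)) (Plus (Smult c s) (Smult c t))"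
| Smult_add: "lie_eq (Smult (c + d) s) (Plus (Smult c s) (Smult d s))"
| Smult_Smult: "lie_eq (Smult c (Smult d s)) (Smult (c * d) s)"
| Smult_one: "lie_eq (Smult 1 s) s"
| Brk_Plus_left: "lie_eq (Brk (Plus s t) u) (Plus (Brk s u) (Brk t u))"
| Brk_Plus_right: "lie_eq (Brk s (Plus t u)) (Plus (Brk s t) (Brk s u))"
| Brk_Smult_left: "lie_eq (Brk (Smult c s) t) (Smult c (Brk s t))"
| Brk_Smult_right: "lie_eq (Brk s (Smult c t)) (Smult c (Brk s t))"
| Brk_self: "lie_eq (Brk s s) Null"
| Jacobi: "lie_eq (Plus (Plus (Brk s (Brk t u)) (Brk t (Brk u s))) (Brk u (Brk s t))) Null"

primrec expr_eval ::
  "('k \<Rightarrow> 'l::ab_group_add \<Rightarrow> 'l) \<Rightarrow> ('l \<Rightarrow> 'l \<Rightarrow> 'l) \<Rightarrow> ('i \<Rightarrow> 'l) \<Rightarrow> ('k, 'i) lie_expr \<Rightarrow> 'l" where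
  "expr_eval scale bracket a (Gen i) = a i"
| "expr_eval scale bracket a Null = 0"
| "expr_eval scale bracket a (Plus s t) = expr_eval scale bracket a s + expr_eval scale bracket a t"
| "expr_eval scale bracket a (Smult c s) = scale c (expr_eval scale bracket a s)"
| "expr_eval scale bracket a (Brk s t) =
     bracket (expr_eval scale bracket a s) (expr_eval scale bracket a t)"

locale free_lie_algebra = lie_algebra scale bracket
  for scale :: "'k::field \<Rightarrow> 'l::ab_group_add \<Rightarrow> 'l" and bracket :: "'l \<Rightarrow> 'l \<Rightarrow> 'l" +
  fixes I :: "'i set" and a :: "'i \<Rightarrow> 'l"
  assumes generated: "\<exists>t. gens t \<subseteq> I \<and> expr_eval scale bracket a t = x"
    and relations: "gens s \<subseteq> I \<Longrightarrow> gens t \<subseteq> I \<Longrightarrow>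
      expr_eval scale bracket a s = expr_eval scale bracket a t \<Longrightarrow> lie_eq s t"

definition lie_hom ::
  "('k \<Rightarrow> 'l::ab_group_add \<Rightarrow> 'l) \<Rightarrow> ('l \<Rightarrow> 'l \<Rightarrow> 'l) \<Rightarrow>
   ('k \<Rightarrow> 'm::ab_group_add \<Rightarrow> 'm) \<Rightarrow> ('m \<Rightarrow> 'm \<Rightarrow> 'm) \<Rightarrow> ('l \<Rightarrow> 'm) \<Rightarrow> bool" where
  "lie_hom scale bracket scale' bracket' \<phi> \<longleftrightarrow>
     (\<forall>x y. \<phi> (x + y) = \<phi> x + \<phi> y) \<and> (\<forall>c x. \<phi> (scale c x) = scale' c (\<phi> x)) \<and>
     (\<forall>x y. \<phi> (bracket x y) = bracket' (\<phi> x) (\<phi> y))"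

lemma (in lie_algebra) lie_eq_sound:
  "lie_eq s t \<Longrightarrow> expr_eval scale bracket f s = expr_eval scale bracket f t"
  by (induction rule: lie_eq.induct)
    (simp_all add: bracket_add_left bracket_add_right bracket_scale_left bracket_scale_right
      bracket_self jacobi scale_left_distrib scale_right_distrib)

lemma expr_eval_cong:
  "(\<And>i. i \<in> gens t \<Longrightarrow> f i = g i) \<Longrightarrow> expr_eval scale bracket f t = expr_eval scale bracket g t"
  by (induction t) auto

lemma lie_hom_expr_eval:
  fixes scale :: "'k \<Rightarrow> 'l::ab_group_add \<Rightarrow> 'l" and scale' :: "'k \<Rightarrow> 'm::ab_group_add \<Rightarrow> 'm"
  assumes "lie_hom scale bracket scale' bracket' \<phi>"
  shows "\<phi> (expr_eval scale bracket f t) = expr_eval scale' bracket' (\<phi> \<circ> f) t"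
proof -
  have "\<phi> 0 + \<phi> 0 = \<phi> 0" using assms unfolding lie_hom_def by (metis add_0)
  then have "\<phi> 0 = 0" by simp
  then show ?thesis using assms by (induction t) (auto simp: lie_hom_def)
qed

text \<open>The universal property, for target algebras over an arbitrary type.\<close>

theorem (in free_lie_algebra) universal_property:
  fixes scale' :: "'k \<Rightarrow> 'm::ab_group_add \<Rightarrow> 'm" and bracket' :: "'m \<Rightarrow> 'm \<Rightarrow> 'm" and f :: "'i \<Rightarrow> 'm"
  assumes "lie_algebra scale' bracket'"
  shows "\<exists>!\<phi>. lie_hom scale bracket scale' bracket' \<phi> \<and> (\<forall>i\<in>I. \<phi> (a i) = f i)"
proof -
  interpret M: lie_algebra scale' bracket' by fact
  let ?e = "expr_eval scale bracket a" and ?f = "expr_eval scale' bracket' f"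
  define rep where "rep x = (SOME t. gens t \<subseteq> I \<and> ?e t = x)" for x
  have rep: "gens (rep x) \<subseteq> I \<and> ?e (rep x) = x" for x
    unfolding rep_def using someI_ex[OF generated] .
  define \<phi> where "\<phi> x = ?f (rep x)" for x
  have \<phi>: "\<phi> (?e t) = ?f t" if "gens t \<subseteq> I" for t
    unfolding \<phi>_def using that rep by (intro M.lie_eq_sound relations) auto
  have "\<phi> (x + y) = \<phi> x + \<phi> y" for x y
    using \<phi>[of "Plus (rep x) (rep y)"] rep[of x] rep[of y] by (simp add: \<phi>_def[symmetric])
  moreover have "\<phi> (scale c x) = scale' c (\<phi> x)" for c x
    using \<phi>[of "Smult c (rep x)"] rep[of x] by (simp add: \<phi>_def[symmetric])
  moreover have "\<phi> (bracket x y) = bracket' (\<phi> x) (\<phi> y)" for x y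
    using \<phi>[of "Brk (rep x) (rep y)"] rep[of x] rep[of y] by (simp add: \<phi>_def[symmetric])
  moreover have "\<phi> (a i) = f i" if "i \<in> I" for i
    using \<phi>[of "Gen i"] that by simp
  ultimately have 1: "lie_hom scale bracket scale' bracket' \<phi> \<and> (\<forall>i\<in>I. \<phi> (a i) = f i)"
    by (simp add: lie_hom_def)
  have 2: "\<psi> x = ?f (rep x)"
    if "lie_hom scale bracket scale' bracket' \<psi> \<and> (\<forall>i\<in>I. \<psi> (a i) = f i)" for \<psi> x
  proof -
    have "\<psi> x = expr_eval scale' bracket' (\<psi> \<circ> a) (rep x)"
      using lie_hom_expr_eval[of scale bracket scale' bracket' \<psi> a "rep x"] that rep[of x] by simp
    also have "\<dots> = ?f (rep x)"
      using that rep[of x] by (intro expr_eval_cong) auto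
    finally show ?thesis .
  qed
  show ?thesis
    using 1 2 by (intro ex1I[of _ \<phi>]) (auto simp: \<phi>_def fun_eq_iff)
qed

section \<open>Diophantine problems\<close>

text \<open>A constant occurs in an equation through an index in the chosen numbering.\<close>

datatype ring_term =
    RVar nat | RConst nat | RAdd ring_term ring_term | RNeg ring_term | RMul ring_term ring_term

primrec ring_eval :: "(nat \<Rightarrow> 'k::field) \<Rightarrow> (nat \<Rightarrow> 'k) \<Rightarrow> ring_term \<Rightarrow> 'k" where
  "ring_eval \<kappa> v (RVar i) = v i"
| "ring_eval \<kappa> v (RConst i) = \<kappa> i"
| "ring_eval \<kappa> v (RAdd s t) = ring_eval \<kappa> v s + ring_eval \<kappa> v t"
| "ring_eval \<kappa> v (RNeg s) = - ring_eval \<kappa> v s"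
| "ring_eval \<kappa> v (RMul s t) = ring_eval \<kappa> v s * ring_eval \<kappa> v t"

primrec ring_code :: "ring_term \<Rightarrow> nat" where
  "ring_code (RVar i) = 5 * i"
| "ring_code (RConst i) = 5 * i + 1"
| "ring_code (RAdd s t) = 5 * prod_encode (ring_code s, ring_code t) + 2"
| "ring_code (RNeg s) = 5 * ring_code s + 3"
| "ring_code (RMul s t) = 5 * prod_encode (ring_code s, ring_code t) + 4"

datatype lie_term =
    LVar nat | LConst nat | LAdd lie_term lie_term | LScale nat lie_term | LBrk lie_term lie_term

primrec lie_eval ::
  "('k::field \<Rightarrow> 'l::ab_group_add \<Rightarrow> 'l) \<Rightarrow> ('l \<Rightarrow> 'l \<Rightarrow> 'l) \<Rightarrow> (nat \<Rightarrow> 'k) \<Rightarrow> (nat \<Rightarrow> 'l) \<Rightarrow>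
   (nat \<Rightarrow> 'l) \<Rightarrow> lie_term \<Rightarrow> 'l" where
  "lie_eval scale bracket \<kappa> \<mu> v (LVar i) = v i"
| "lie_eval scale bracket \<kappa> \<mu> v (LConst i) = \<mu> i"
| "lie_eval scale bracket \<kappa> \<mu> v (LAdd s t) =
     lie_eval scale bracket \<kappa> \<mu> v s + lie_eval scale bracket \<kappa> \<mu> v t"
| "lie_eval scale bracket \<kappa> \<mu> v (LScale i s) = scale (\<kappa> i) (lie_eval scale bracket \<kappa> \<mu> v s)"
| "lie_eval scale bracket \<kappa> \<mu> v (LBrk s t) =
     bracket (lie_eval scale bracket \<kappa> \<mu> v s) (lie_eval scale bracket \<kappa> \<mu> v t)"

primrec lie_code :: "lie_term \<Rightarrow> nat" where
  "lie_code (LVar i) = 5 * i"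
| "lie_code (LConst i) = 5 * i + 1"
| "lie_code (LAdd s t) = 5 * prod_encode (lie_code s, lie_code t) + 2"
| "lie_code (LScale i s) = 5 * prod_encode (i, lie_code s) + 3"
| "lie_code (LBrk s t) = 5 * prod_encode (lie_code s, lie_code t) + 4"

definition has_solution :: "(('v \<Rightarrow> 'a) \<Rightarrow> 't \<Rightarrow> 'a) \<Rightarrow> ('t \<times> 't) list \<Rightarrow> bool" where
  "has_solution ev S \<longleftrightarrow> (\<exists>v. \<forall>(s, t) \<in> set S. ev v s = ev v t)"

definition system_code :: "('t \<Rightarrow> nat) \<Rightarrow> ('t \<times> 't) list \<Rightarrow> nat" where
  "system_code code S = list_encode (map (\<lambda>(s, t). prod_encode (code s, code t)) S)"

definition diophantine_problem_field :: "(nat \<Rightarrow> 'k::field) \<Rightarrow> nat set" where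
  "diophantine_problem_field \<kappa> = system_code ring_code ` {S. has_solution (ring_eval \<kappa>) S}"

definition diophantine_problem_lie ::
  "('k::field \<Rightarrow> 'l::ab_group_add \<Rightarrow> 'l) \<Rightarrow> ('l \<Rightarrow> 'l \<Rightarrow> 'l) \<Rightarrow> (nat \<Rightarrow> 'k) \<Rightarrow> (nat \<Rightarrow> 'l) \<Rightarrow> nat set" where
  "diophantine_problem_lie scale bracket \<kappa> \<mu> =
     system_code lie_code ` {S. has_solution (lie_eval scale bracket \<kappa> \<mu>) S}"

text \<open>The codings are bijective: every natural number is the code of exactly one system.\<close>

lemma code_arith:
  fixes x y :: nat
  shows "5 * x \<noteq> Suc (5 * y)" "5 * x \<noteq> Suc (Suc (5 * y))" "5 * x \<noteq> 3 + 5 * y" "5 * x \<noteq> 5 * y + 3"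
    "5 * x \<noteq> 5 * y + 4" "Suc (5 * y) \<noteq> 5 * x" "Suc (Suc (5 * y)) \<noteq> 5 * x"
    "3 + 5 * y \<noteq> 5 * x" "5 * y + 3 \<noteq> 5 * x" "5 * y + 4 \<noteq> 5 * x"
  by presburger+

lemma bij_ring_code: "bij ring_code"
proof -
  have "s = t" if "ring_code s = ring_code t" for s t
    using that
  proof (induction s arbitrary: t)
    case (RVar i)
    then show ?case by (cases t) (auto simp: code_arith)
  next
    case (RConst i)
    then show ?case by (cases t) (auto simp: code_arith)
  next
    case (RAdd s1 s2)
    from RAdd.prems show ?case by (cases t) (auto simp: code_arith dest: RAdd.IH)
  next
    case (RNeg s1)
    from RNeg.prems show ?case by (cases t) (auto simp: code_arith dest: RNeg.IH)
  next
    case (RMul s1 s2)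
    from RMul.prems show ?case by (cases t) (auto simp: code_arith dest: RMul.IH)
  qed
  moreover have "\<exists>t. ring_code t = m" for m
  proof (induction m rule: less_induct)
    case (less m)
    obtain q r where m: "m = 5 * q + r" "r < 5"
      by (metis mod_less_divisor mult_div_mod_eq zero_less_numeral)
    obtain x y where q: "q = prod_encode (x, y)"
      by (metis prod_decode_inverse surj_pair)
    have le: "x \<le> q" "y \<le> q"
      using q by (simp_all add: le_prod_encode_1 le_prod_encode_2)
    consider "r = 0" | "r = 1" | "r \<ge> 2" by linarith
    then show ?case
    proof cases
      case 1
      then have "ring_code (RVar q) = m" using m by simp
      then show ?thesis ..
    next
      case 2
      then have "ring_code (RConst q) = m" using m by simp
      then show ?thesis ..
    next
      case 3
      obtain s t u where stu: "ring_code s = x" "ring_code t = y" "ring_code u = q"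
        using less.IH[of x] less.IH[of y] less.IH[of q] le m(1) 3 by auto
      consider "r = 2" | "r = 3" | "r = 4" using 3 m(2) by linarith
      then show ?thesis
      proof cases
        case 1
        then have "ring_code (RAdd s t) = m" using m q stu by simp
        then show ?thesis ..
      next
        case 2
        then have "ring_code (RNeg u) = m" using m q stu by simp
        then show ?thesis ..
      next
        case 3
        then have "ring_code (RMul s t) = m" using m q stu by simp
        then show ?thesis ..
      qed
    qed
  qed
  ultimately show ?thesis
    unfolding bij_def inj_def surj_def by metis
qed

lemma bij_lie_code: "bij lie_code"
proof -
  have "s = t" if "lie_code s = lie_code t" for s t
    using that
  proof (induction s arbitrary: t)
    case (LVar i)
    then show ?case by (cases t) (auto simp: code_arith)
  next
    case (LConst i)
    then show ?case by (cases t) (auto simp: code_arith)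
  next
    case (LAdd s1 s2)
    from LAdd.prems show ?case by (cases t) (auto simp: code_arith dest: LAdd.IH)
  next
    case (LScale i s1)
    from LScale.prems show ?case by (cases t) (auto simp: code_arith dest: LScale.IH)
  next
    case (LBrk s1 s2)
    from LBrk.prems show ?case by (cases t) (auto simp: code_arith dest: LBrk.IH)
  qed
  moreover have "\<exists>t. lie_code t = m" for m
  proof (induction m rule: less_induct)
    case (less m)
    obtain q r where m: "m = 5 * q + r" "r < 5"
      by (metis mod_less_divisor mult_div_mod_eq zero_less_numeral)
    obtain x y where q: "q = prod_encode (x, y)"
      by (metis prod_decode_inverse surj_pair)
    have le: "x \<le> q" "y \<le> q"
      using q by (simp_all add: le_prod_encode_1 le_prod_encode_2)
    consider "r = 0" | "r = 1" | "r \<ge> 2" by linarith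
    then show ?case
    proof cases
      case 1
      then have "lie_code (LVar q) = m" using m by simp
      then show ?thesis ..
    next
      case 2
      then have "lie_code (LConst q) = m" using m by simp
      then show ?thesis ..
    next
      case 3
      obtain s t u where stu: "lie_code s = x" "lie_code t = y" "lie_code u = q"
        using less.IH[of x] less.IH[of y] less.IH[of q] le m(1) 3 by auto
      consider "r = 2" | "r = 3" | "r = 4" using 3 m(2) by linarith
      then show ?thesis
      proof cases
        case 1
        then have "lie_code (LAdd s t) = m" using m q stu by simp
        then show ?thesis ..
      next
        case 2
        then have "lie_code (LScale x t) = m" using m q stu by simp
        then show ?thesis ..
      next
        case 3
        then have "lie_code (LBrk s t) = m" using m q stu by simp
        then show ?thesis ..
      qed
    qed
  qed
  ultimately show ?thesis
    unfolding bij_def inj_def surj_def by metis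
qed

lemma bij_system_code:
  assumes "bij code"
  shows "bij (system_code code)"
proof -
  have "bij (\<lambda>(s, t). prod_encode (code s, code t))"
    using bij_comp[OF bij_betw_map_prod[OF assms assms, simplified] bij_prod_encode]
    by (simp add: comp_def map_prod_def case_prod_beta')
  then have "bij (map (\<lambda>(s, t). prod_encode (code s, code t)))"
    by (metis bij_def inj_mapI lists_UNIV lists_image)
  from bij_comp[OF this bij_list_encode] show ?thesis
    by (simp add: comp_def system_code_def[abs_def])
qed

end

theory Submission
  imports Defs "HOL-Library.Product_Plus"
begin

text \<open>
  A scalar \<open>\<alpha>\<close> is encoded by the pair \<open>X = \<alpha> a\<^sub>1\<close>, \<open>Y = \<alpha> a\<^sub>2\<close>, subject to \<open>[X, a\<^sub>1] = 0\<close> and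
  \<open>[X, a\<^sub>2] = [a\<^sub>1, Y]\<close>. Sums are then linear equations, and \<open>\<gamma> = \<alpha> \<beta>\<close> becomes
  \<open>[\<alpha> a\<^sub>1, \<beta> a\<^sub>2] = [\<gamma> a\<^sub>1, a\<^sub>2]\<close>. No knowledge of centralizers in the free algebra is needed to
  read a solution in \<open>K\<close> off a solution in \<open>L\<close>: push the latter forward to the two-dimensional
  algebra with basis \<open>x, y\<close> and \<open>[x, y] = y\<close> along the homomorphism \<open>a\<^sub>1 \<mapsto> x\<close>, \<open>a\<^sub>2 \<mapsto> y\<close>. There the
  equations force \<open>X = \<alpha> x\<close> and \<open>Y \<in> K x + \<alpha> y\<close>, whence \<open>[X, Y'] = \<alpha> \<alpha>' y\<close>.

  To keep the reduction easily computable, the Lie variables \<open>2 m\<close> and \<open>2 m + 1\<close> hold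
  the encoding of the value of the ring term with code \<open>m\<close>, and the defining equations are written
  down for all codes below the code of the given system, whether they occur in it or not.
\<close>

section \<open>Recursive functions\<close>

text \<open>Arguments come as one list, so that a single set of closure rules serves every
  arity.\<close>

definition computable_on :: "nat \<Rightarrow> (nat list \<Rightarrow> nat) \<Rightarrow> bool" where
  "computable_on k f \<longleftrightarrow> (\<exists>p. \<forall>xs. length xs = k \<longrightarrow> rec_eval p xs (f xs))"

lemma computable_on_Suc_0_iff: "computable_on (Suc 0) f \<longleftrightarrow> computable1 (\<lambda>x. f [x])"
  by (auto simp: computable_on_def computable1_def length_Suc_conv)

lemma computable_on_2_iff:
  "computable_on (Suc (Suc 0)) f \<longleftrightarrow> computable2 (\<lambda>x y. f [x, y])"
proof -
  have "(\<forall>xs. length xs = Suc (Suc 0) \<longrightarrow> rec_eval p xs (f xs)) \<longleftrightarrow>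
      (\<forall>x y. rec_eval p [x, y] (f [x, y]))" for p
    by (auto simp: length_Suc_conv)
  then show ?thesis by (simp add: computable_on_def computable2_def)
qed

lemma computable_on_nth: "i < k \<Longrightarrow> computable_on k (\<lambda>xs. xs ! i)"
  unfolding computable_on_def by (rule exI[of _ "Proj i"]) (auto intro: rec_eval.Proj)

lemma computable_on_comp1:
  assumes "computable1 f" "computable_on k g"
  shows "computable_on k (\<lambda>xs. f (g xs))"
proof -
  obtain p q where "\<forall>x. rec_eval p [x] (f x)" "\<forall>xs. length xs = k \<longrightarrow> rec_eval q xs (g xs)"
    using assms unfolding computable1_def computable_on_def by blast
  then have "\<forall>xs. length xs = k \<longrightarrow> rec_eval (Comp p [q]) xs (f (g xs))"
    by (auto intro: rec_eval.Comp[where ys = "[g xs]" for xs])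
  then show ?thesis unfolding computable_on_def by blast
qed

lemma computable_on_comp2:
  assumes "computable2 f" "computable_on k g" "computable_on k h"
  shows "computable_on k (\<lambda>xs. f (g xs) (h xs))"
proof -
  obtain p q r where "\<forall>x y. rec_eval p [x, y] (f x y)"
    "\<forall>xs. length xs = k \<longrightarrow> rec_eval q xs (g xs)" "\<forall>xs. length xs = k \<longrightarrow> rec_eval r xs (h xs)"
    using assms unfolding computable2_def computable_on_def by blast
  then have "\<forall>xs. length xs = k \<longrightarrow> rec_eval (Comp p [q, r]) xs (f (g xs) (h xs))"
    by (auto intro: rec_eval.Comp[where ys = "[g xs, h xs]" for xs])
  then show ?thesis unfolding computable_on_def by blast
qed

lemma computable_on_Suc: "computable_on k g \<Longrightarrow> computable_on k (\<lambda>xs. Suc (g xs))"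
  by (rule computable_on_comp1) (auto simp: computable1_def intro: rec_eval.Succ)

lemma computable_on_const: "computable_on k (\<lambda>xs. c)"
proof (induction c)
  case 0
  show ?case unfolding computable_on_def by (auto intro: rec_eval.Zero)
qed (rule computable_on_Suc)

lemma computable_on_primrec:
  assumes "computable_on k f" "computable_on (Suc (Suc k)) g"
    and "\<And>xs. length xs = k \<Longrightarrow> h (0 # xs) = f xs"
    and "\<And>x xs. length xs = k \<Longrightarrow> h (Suc x # xs) = g (x # h (x # xs) # xs)"
  shows "computable_on (Suc k) h"
proof -
  obtain p q where p: "\<And>xs. length xs = k \<Longrightarrow> rec_eval p xs (f xs)"
    and q: "\<And>xs. length xs = Suc (Suc k) \<Longrightarrow> rec_eval q xs (g xs)"
    using assms(1,2) unfolding computable_on_def by blast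
  have "rec_eval (PrimRec p q) (x # xs) (h (x # xs))" if "length xs = k" for x xs
  proof (induction x)
    case 0
    show ?case using that p assms(3) by (auto intro: rec_eval.PrimRec_0)
  next
    case (Suc x)
    show ?case
      using rec_eval.PrimRec_Suc[OF Suc.IH q] that assms(4) by simp
  qed
  then show ?thesis unfolding computable_on_def by (metis length_Suc_conv)
qed

text \<open>The second assumption makes the search total; the values of \<open>g\<close> before the
  minimum are nonzero, hence successors, as the semantics of \<open>Mu\<close> demands.\<close>

lemma computable_on_Least:
  assumes "computable_on (Suc k) g" "\<And>xs. length xs = k \<Longrightarrow> \<exists>y. g (y # xs) = 0"
  shows "computable_on k (\<lambda>xs. LEAST y. g (y # xs) = 0)"
proof -
  obtain p where p: "\<And>xs. length xs = Suc k \<Longrightarrow> rec_eval p xs (g xs)"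
    using assms(1) unfolding computable_on_def by blast
  have "rec_eval (Mu p) xs (LEAST y. g (y # xs) = 0)" if xs: "length xs = k" for xs
  proof (rule rec_eval.Mu)
    show "rec_eval p ((LEAST y. g (y # xs) = 0) # xs) 0"
      using p[of "(LEAST y. g (y # xs) = 0) # xs"] LeastI_ex[OF assms(2)[OF xs]] xs by simp
  next
    fix z assume "z < (LEAST y. g (y # xs) = 0)"
    then have "g (z # xs) \<noteq> 0" by (rule not_less_Least)
    then show "\<exists>v. rec_eval p (z # xs) (Suc v)"
      using p[of "z # xs"] xs by (metis length_Cons not0_implies_Suc)
  qed
  then show ?thesis unfolding computable_on_def by blast
qed

lemma computable2_add: "computable2 (+)"
  unfolding computable_on_2_iff[of "\<lambda>xs. xs ! 0 + xs ! 1", simplified, symmetric]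
  by (rule computable_on_primrec[where f = "\<lambda>xs. xs ! 0" and g = "\<lambda>xs. Suc (xs ! 1)"])
    (auto intro!: computable_on_nth computable_on_Suc)

lemmas computable_on_add = computable_on_comp2[OF computable2_add]

lemma computable2_mult: "computable2 (*)"
  unfolding computable_on_2_iff[of "\<lambda>xs. xs ! 0 * xs ! 1", simplified, symmetric]
  by (rule computable_on_primrec[where f = "\<lambda>xs. 0" and g = "\<lambda>xs. xs ! 2 + xs ! 1"])
    (auto intro!: computable_on_nth computable_on_const computable_on_add)

lemmas computable_on_mult = computable_on_comp2[OF computable2_mult]

lemma computable1_pred: "computable1 (\<lambda>x. x - 1)"
proof -
  have "computable_on (Suc 0) (\<lambda>xs. xs ! 0 - 1)"
    by (rule computable_on_primrec[where f = "\<lambda>xs. 0" and g = "\<lambda>xs. xs ! 0"])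
      (auto intro!: computable_on_nth computable_on_const)
  then show ?thesis by (simp add: computable_on_Suc_0_iff)
qed

lemmas computable_on_pred = computable_on_comp1[OF computable1_pred]

lemma computable_on_diff:
  assumes "computable_on k g" "computable_on k h"
  shows "computable_on k (\<lambda>xs. g xs - h xs)"
proof -
  \<comment> \<open>Primitive recursion runs on the first argument, here the subtrahend; hence the
    exchanged order.\<close>
  have "computable_on (Suc (Suc 0)) (\<lambda>xs. xs ! 1 - xs ! 0)"
    by (rule computable_on_primrec[where f = "\<lambda>xs. xs ! 0" and g = "\<lambda>xs. xs ! 1 - 1"])
      (auto intro!: computable_on_nth computable_on_pred[unfolded One_nat_def])
  then have "computable2 (\<lambda>x y. y - x)" by (simp add: computable_on_2_iff)
  from computable_on_comp2[OF this assms(2,1)] show ?thesis .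
qed

section \<open>Cantor pairing and its inverse\<close>

lemma computable1_triangle: "computable1 triangle"
  unfolding computable_on_Suc_0_iff[of "\<lambda>xs. triangle (xs ! 0)", simplified, symmetric]
  by (rule computable_on_primrec[where f = "\<lambda>xs. 0" and g = "\<lambda>xs. xs ! 1 + Suc (xs ! 0)"])
    (auto intro!: computable_on_nth computable_on_const computable_on_add computable_on_Suc)

lemmas computable_on_triangle = computable_on_comp1[OF computable1_triangle]

lemma computable_on_prod_encode:
  assumes "computable_on k g" "computable_on k h"
  shows "computable_on k (\<lambda>xs. prod_encode (g xs, h xs))"
  unfolding prod_encode_def by (auto intro!: assms computable_on_add computable_on_triangle)

lemma prod_decode_triangle:
  "z = triangle (fst (prod_decode z) + snd (prod_decode z)) + fst (prod_decode z)"
proof -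
  have "prod_encode (i, j) = triangle (i + j) + i" for i j by (simp add: prod_encode_def)
  from this[of "fst (prod_decode z)" "snd (prod_decode z)"] show ?thesis by simp
qed

text \<open>\<open>z\<close> lies on the antidiagonal \<open>k\<close> with
  \<open>triangle k \<le> z < triangle (Suc k)\<close>. Truncated subtraction turns the second
  inequality into a zero test, the form that unbounded search requires.\<close>

lemma diagonal_eq_Least:
  "fst (prod_decode z) + snd (prod_decode z) = (LEAST k. Suc z - triangle (Suc k) = 0)"
proof -
  obtain i j where z: "prod_decode z = (i, j)" by fastforce
  then have zt: "z = triangle (i + j) + i" using prod_decode_triangle[of z] by simp
  have mono: "triangle m \<le> triangle n" if "m \<le> n" for m n
    using that by (induction rule: dec_induct) auto
  have "(LEAST k. Suc z - triangle (Suc k) = 0) = i + j"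
  proof (rule Least_equality)
    fix k assume "Suc z - triangle (Suc k) = 0"
    then show "i + j \<le> k"
      using mono[of "Suc k" "i + j"] zt by (cases "i + j \<le> k") auto
  qed (simp add: zt)
  then show ?thesis by (simp add: z)
qed

lemma computable1_diagonal: "computable1 (\<lambda>z. fst (prod_decode z) + snd (prod_decode z))"
proof -
  have "computable_on (Suc 0) (\<lambda>xs. LEAST y. Suc ((y # xs) ! 1) - triangle (Suc ((y # xs) ! 0)) = 0)"
  proof (rule computable_on_Least)
    fix xs :: "nat list"
    have "n \<le> triangle n" for n by (induction n) auto
    then show "\<exists>y. Suc ((y # xs) ! 1) - triangle (Suc ((y # xs) ! 0)) = 0"
      by (intro exI[of _ "xs ! 0"]) simp
  qed (intro computable_on_diff computable_on_Suc computable_on_triangle computable_on_nth; simp)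
  then show ?thesis
    unfolding diagonal_eq_Least by (simp add: computable_on_Suc_0_iff)
qed

lemmas computable_on_diagonal = computable_on_comp1[OF computable1_diagonal]

lemma computable_on_fst_prod_decode:
  assumes "computable_on k g"
  shows "computable_on k (\<lambda>xs. fst (prod_decode (g xs)))"
proof -
  have "z - triangle (fst (prod_decode z) + snd (prod_decode z)) = fst (prod_decode z)" for z
    using prod_decode_triangle[of z] by linarith
  moreover have "computable_on k
      (\<lambda>xs. g xs - triangle (fst (prod_decode (g xs)) + snd (prod_decode (g xs))))"
    by (intro assms computable_on_diff computable_on_triangle computable_on_diagonal)
  ultimately show ?thesis by simp
qed

lemma computable_on_snd_prod_decode:
  assumes "computable_on k g"
  shows "computable_on k (\<lambda>xs. snd (prod_decode (g xs)))"
proof -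
  have "computable_on k
      (\<lambda>xs. (fst (prod_decode (g xs)) + snd (prod_decode (g xs))) - fst (prod_decode (g xs)))"
    by (intro assms computable_on_diff computable_on_diagonal computable_on_fst_prod_decode)
  then show ?thesis by simp
qed

section \<open>List codes\<close>

text \<open>Since \<open>prod_decode 0 = (0, 0)\<close>, the empty list has tail \<open>0\<close>, its own code, and head \<open>0\<close>; as the
  code of an equation, \<open>0\<close> stands for the trivial one between \<open>RVar 0\<close> and itself.\<close>

definition code_hd :: "nat \<Rightarrow> nat" where
  "code_hd c = fst (prod_decode (c - 1))"

definition code_tl :: "nat \<Rightarrow> nat" where
  "code_tl c = snd (prod_decode (c - 1))"

definition code_nth :: "nat \<Rightarrow> nat \<Rightarrow> nat" where
  "code_nth c k = code_hd ((code_tl ^^ k) c)"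

lemma prod_decode_0: "prod_decode 0 = (0, 0)"
  using prod_encode_inverse[of "(0, 0)"] by (simp add: prod_encode_def)

lemma code_hd_list_encode: "code_hd (list_encode xs) = (if xs = [] then 0 else hd xs)"
  by (cases xs) (auto simp: code_hd_def prod_decode_0)

lemma code_tl_list_encode: "code_tl (list_encode xs) = list_encode (tl xs)"
  by (cases xs) (auto simp: code_tl_def prod_decode_0)

lemma code_nth_list_encode: "code_nth (list_encode xs) k = (if k < length xs then xs ! k else 0)"
proof -
  have "(code_tl ^^ k) (list_encode xs) = list_encode (drop k xs)"
    by (induction k) (auto simp: code_tl_list_encode drop_Suc drop_tl)
  then show ?thesis by (auto simp: code_nth_def code_hd_list_encode hd_drop_conv_nth)
qed

text \<open>With the next bound, this lets the code of a system bound both the positions and the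
  codes of its equations.\<close>

lemma length_le_list_encode: "length xs \<le> list_encode xs"
proof (induction xs)
  case (Cons x xs)
  then show ?case using le_prod_encode_2[of "list_encode xs" x] by simp
qed simp

lemma less_list_encode: "x \<in> set xs \<Longrightarrow> x < list_encode xs"
proof (induction xs)
  case (Cons y xs)
  then show ?case
    using le_prod_encode_2[of "list_encode xs" y] le_prod_encode_1[of y "list_encode xs"] by auto
qed simp

lemma computable_on_code_nth:
  assumes "computable_on k g" "computable_on k h"
  shows "computable_on k (\<lambda>xs. code_nth (g xs) (h xs))"
proof -
  have "computable_on (Suc (Suc 0)) (\<lambda>xs. (code_tl ^^ (xs ! 0)) (xs ! 1))"
    by (rule computable_on_primrec[where f = "\<lambda>xs. xs ! 0" and g = "\<lambda>xs. code_tl (xs ! 1)"])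
      (auto simp: code_tl_def
        intro!: computable_on_nth computable_on_snd_prod_decode computable_on_pred[unfolded One_nat_def])
  then have "computable2 (\<lambda>x y. (code_tl ^^ x) y)" by (simp add: computable_on_2_iff)
  from computable_on_comp2[OF this assms(2,1)] show ?thesis
    unfolding code_nth_def code_hd_def
    by (intro computable_on_fst_prod_decode computable_on_pred)
qed

section \<open>The reduction\<close>

text \<open>Here \<open>c\<^sub>1\<close> and \<open>c\<^sub>2\<close> are indices of \<open>a\<^sub>1\<close> and \<open>a\<^sub>2\<close>, \<open>N\<close> is the code of the system over \<open>K\<close>,
  and \<open>[a\<^sub>1, a\<^sub>1]\<close> serves as a term for zero.\<close>

definition lie_equations :: "nat \<Rightarrow> nat \<Rightarrow> nat \<Rightarrow> nat \<Rightarrow> (lie_term \<times> lie_term) list" where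
  "lie_equations c\<^sub>1 c\<^sub>2 N q =
    (let A = LConst c\<^sub>1; B = LConst c\<^sub>2; X = (\<lambda>m. LVar (2 * m)); Y = (\<lambda>m. LVar (2 * m + 1));
         i = fst (prod_decode q); j = snd (prod_decode q); e = code_nth N q in
     [(LBrk (X q) A, LBrk A A),
      (LBrk (X q) B, LBrk A (Y q)),
      (X (5 * q + 1), LScale q A),
      (X (5 * q + 2), LAdd (X i) (X j)),
      (LAdd (X (5 * q + 3)) (X q), LBrk A A),
      (LBrk (X (5 * q + 4)) B, LBrk (X i) (Y j)),
      (X (fst (prod_decode e)), X (snd (prod_decode e)))])"

text \<open>Bound and input code are separate arguments: the recursion lowers the bound while
  \<open>N\<close>, from which the equations of the input are read, stays fixed.\<close>

primrec lie_system :: "nat \<Rightarrow> nat \<Rightarrow> nat \<Rightarrow> nat \<Rightarrow> (lie_term \<times> lie_term) list" where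
  "lie_system c\<^sub>1 c\<^sub>2 N 0 = []"
| "lie_system c\<^sub>1 c\<^sub>2 N (Suc q) = lie_equations c\<^sub>1 c\<^sub>2 N q @ lie_system c\<^sub>1 c\<^sub>2 N q"

lemma set_lie_system: "set (lie_system c\<^sub>1 c\<^sub>2 N k) = (\<Union>q<k. set (lie_equations c\<^sub>1 c\<^sub>2 N q))"
  by (induction k) (auto simp: lessThan_Suc)

lemma computable1_lie_system: "computable1 (\<lambda>N. system_code lie_code (lie_system c\<^sub>1 c\<^sub>2 N N))"
proof -
  have "computable_on (Suc (Suc 0)) (\<lambda>xs. system_code lie_code (lie_system c\<^sub>1 c\<^sub>2 (xs ! 1) (xs ! 0)))"
  proof (rule computable_on_primrec)
    show "computable_on (Suc 0) (\<lambda>xs. 0)" by (rule computable_on_const)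
    \<comment> \<open>Prepending a block of fixed length is a fixed composition of pairings. The
      entries of \<open>xs\<close> are the index \<open>q\<close>, the code built so far and
      \<open>N\<close>.\<close>
    let ?g = "\<lambda>xs. foldr (\<lambda>(s, t) r. Suc (prod_encode (prod_encode (lie_code s, lie_code t), r)))
      (lie_equations c\<^sub>1 c\<^sub>2 (xs ! 2) (xs ! 0)) (xs ! 1)"
    show "computable_on (Suc (Suc (Suc 0))) ?g"
      unfolding lie_equations_def Let_def foldr.simps comp_def id_def case_prod_conv lie_code.simps
      by (intro computable_on_Suc computable_on_prod_encode computable_on_add computable_on_mult
          computable_on_fst_prod_decode computable_on_snd_prod_decode computable_on_code_nth
          computable_on_const computable_on_nth) simp_all
    fix x :: nat and xs :: "nat list"
    have "system_code lie_code (S @ T) =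
        foldr (\<lambda>(s, t) r. Suc (prod_encode (prod_encode (lie_code s, lie_code t), r))) S
          (system_code lie_code T)" for S T
      by (induction S) (auto simp: system_code_def)
    then show "system_code lie_code (lie_system c\<^sub>1 c\<^sub>2 ((Suc x # xs) ! 1) ((Suc x # xs) ! 0)) =
        ?g (x # system_code lie_code (lie_system c\<^sub>1 c\<^sub>2 ((x # xs) ! 1) ((x # xs) ! 0)) # xs)"
      by simp
  qed (simp add: system_code_def)
  then have "computable2 (\<lambda>q N. system_code lie_code (lie_system c\<^sub>1 c\<^sub>2 N q))"
    by (simp add: computable_on_2_iff)
  \<comment> \<open>Bound and input are now identified.\<close>
  from computable_on_comp2[OF this computable_on_nth[of 0 "Suc 0"] computable_on_nth[of 0 "Suc 0"]]
  show ?thesis by (simp add: computable_on_Suc_0_iff)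
qed

section \<open>Transfer of solutions between the field and the Lie algebra\<close>

definition affine_scale :: "'k::field \<Rightarrow> 'k \<times> 'k \<Rightarrow> 'k \<times> 'k" where
  "affine_scale c x = (c * fst x, c * snd x)"

text \<open>Pairs are coordinates for \<open>x = (1, 0)\<close> and \<open>y = (0, 1)\<close>, where
  \<open>[x, y] = y\<close>: the Lie algebra of the affine group of the line.\<close>

definition affine_bracket :: "'k::field \<times> 'k \<Rightarrow> 'k \<times> 'k \<Rightarrow> 'k \<times> 'k" where
  "affine_bracket x y = (0, fst x * snd y - snd x * fst y)"

lemma lie_algebra_affine: "lie_algebra affine_scale affine_bracket"
  by unfold_locales
    (auto simp: affine_scale_def affine_bracket_def prod_eq_iff algebra_simps)

text \<open>Terms have no zero symbol, so the induction uses just the three clauses of a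
  homomorphism.\<close>

lemma lie_hom_lie_eval:
  assumes "lie_hom scale bracket scale' bracket' \<phi>"
  shows "\<phi> (lie_eval scale bracket \<kappa> \<mu> v t) = lie_eval scale' bracket' \<kappa> (\<phi> \<circ> \<mu>) (\<phi> \<circ> v) t"
  using assms by (induction t) (auto simp: lie_hom_def)

text \<open>Bilinearity and \<open>[a, a] = 0\<close> suffice in this direction:
  \<open>[\<alpha> a, b] = [a, \<alpha> b]\<close> and
  \<open>[\<alpha> a, \<beta> b] = \<alpha> \<beta> [a, b]\<close>.\<close>

lemma field_solution_imp_lie_solution:
  fixes scale :: "'k::field \<Rightarrow> 'l::ab_group_add \<Rightarrow> 'l"
  assumes "lie_algebra scale bracket" and "has_solution (ring_eval \<kappa>) S"
  shows "has_solution (lie_eval scale bracket \<kappa> \<mu>) (lie_system c\<^sub>1 c\<^sub>2 (system_code ring_code S) k)"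
proof -
  interpret lie_algebra scale bracket by fact
  obtain w where w: "\<And>s t. (s, t) \<in> set S \<Longrightarrow> ring_eval \<kappa> w s = ring_eval \<kappa> w t"
    using assms(2) unfolding has_solution_def by blast
  \<comment> \<open>Every number codes a ring term, so the equations for terms absent from
    \<open>S\<close> can be satisfied too.\<close>
  define val where "val m = ring_eval \<kappa> w (inv ring_code m)" for m
  have val_code: "val (ring_code t) = ring_eval \<kappa> w t" for t
    unfolding val_def using bij_ring_code by (simp add: bij_is_inj)
  have code_inv: "ring_code (inv ring_code m) = m" for m
    using bij_ring_code by (simp add: bij_is_surj surj_f_inv_f)
  have val_simps: "val (5 * q + 1) = \<kappa> q"
    "val (5 * q + 2) = val (fst (prod_decode q)) + val (snd (prod_decode q))"
    "val (5 * q + 3) = - val q"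
    "val (5 * q + 4) = val (fst (prod_decode q)) * val (snd (prod_decode q))" for q
    using val_code[of "RConst q"]
      val_code[of "RAdd (inv ring_code (fst (prod_decode q))) (inv ring_code (snd (prod_decode q)))"]
      val_code[of "RNeg (inv ring_code q)"]
      val_code[of "RMul (inv ring_code (fst (prod_decode q))) (inv ring_code (snd (prod_decode q)))"]
    by (simp_all add: code_inv val_def[symmetric])
  \<comment> \<open>Positions past the end give \<open>e = 0\<close>, which decodes to
    \<open>(0, 0)\<close>, so both sides agree.\<close>
  have val_pair: "val (fst (prod_decode e)) = val (snd (prod_decode e))"
    if "e = code_nth (system_code ring_code S) q" for e q
  proof (cases "q < length S")
    case True
    then obtain s t where "S ! q = (s, t)" "(s, t) \<in> set S" by (metis nth_mem surj_pair)
    then show ?thesis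
      using that True w by (simp add: system_code_def code_nth_list_encode val_code)
  qed (simp add: that system_code_def code_nth_list_encode prod_decode_0)
  define v where "v m = scale (val (m div 2)) (if even m then \<mu> c\<^sub>1 else \<mu> c\<^sub>2)" for m
  have v: "v (2 * m) = scale (val m) (\<mu> c\<^sub>1)" "v (2 * m + 1) = scale (val m) (\<mu> c\<^sub>2)"
    "v (Suc (2 * m)) = scale (val m) (\<mu> c\<^sub>2)" for m
    by (simp_all add: v_def)
  have "lie_eval scale bracket \<kappa> \<mu> v s = lie_eval scale bracket \<kappa> \<mu> v t"
    if "(s, t) \<in> set (lie_equations c\<^sub>1 c\<^sub>2 (system_code ring_code S) q)" for s t q
    using that val_pair[OF HOL.refl, of q] unfolding lie_equations_def Let_def
    by (auto simp only: list.set insert_iff empty_iff prod.inject lie_eval.simps v val_simps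
        bracket_scale_left bracket_scale_right bracket_self scale_left_distrib scale_zero_right
        scale_scale mult.commute[where 'a = 'k] scale_minus_left add.left_inverse)
  then show ?thesis
    unfolding has_solution_def set_lie_system by blast
qed

text \<open>Equations at indices below \<open>N\<close> are enough: a non-variable term of code
  \<open>5 * q + r\<close> uses index \<open>q\<close>, which does not exceed its code.\<close>

lemma affine_solution_imp_field_solution:
  fixes \<kappa> :: "nat \<Rightarrow> 'k::field"
  assumes "has_solution (lie_eval affine_scale affine_bracket \<kappa> \<mu>)
      (lie_system c\<^sub>1 c\<^sub>2 (system_code ring_code S) (system_code ring_code S))"
    and "\<mu> c\<^sub>1 = (1, 0)" and "\<mu> c\<^sub>2 = (0, 1)"
  shows "has_solution (ring_eval \<kappa>) S"
proof -
  define N where "N = system_code ring_code S"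
  obtain v where v: "\<And>q s t. q < N \<Longrightarrow> (s, t) \<in> set (lie_equations c\<^sub>1 c\<^sub>2 N q) \<Longrightarrow>
      lie_eval affine_scale affine_bracket \<kappa> \<mu> v s = lie_eval affine_scale affine_bracket \<kappa> \<mu> v t"
    using assms(1) unfolding has_solution_def set_lie_system N_def[symmetric] by fast
  define \<alpha> where "\<alpha> m = fst (v (2 * m))" for m
  note eqs = v[unfolded lie_equations_def Let_def list.set]
  note simps = assms(2,3) affine_scale_def affine_bracket_def \<alpha>_def
  have X: "snd (v (2 * q)) = 0" if "q < N" for q
    using eqs[OF that, OF insertI1] by (simp add: simps)
  have Y: "snd (v (2 * q + 1)) = \<alpha> q" if "q < N" for q
    using eqs[OF that, OF insertI2, OF insertI1] by (simp add: simps)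
  have const: "\<alpha> (5 * q + 1) = \<kappa> q" if "q < N" for q
    using eqs[OF that, OF insertI2, OF insertI2, OF insertI1] by (simp add: simps)
  have plus: "\<alpha> (5 * prod_encode (i, j) + 2) = \<alpha> i + \<alpha> j" if "prod_encode (i, j) < N" for i j
    using eqs[OF that, OF insertI2, OF insertI2, OF insertI2, OF insertI1] by (simp add: simps)
  have neg: "\<alpha> (5 * q + 3) = - \<alpha> q" if "q < N" for q
    using eqs[OF that, OF insertI2, OF insertI2, OF insertI2, OF insertI2, OF insertI1]
    by (simp add: simps prod_eq_iff add_eq_0_iff2)
  have mult: "\<alpha> (5 * prod_encode (i, j) + 4) = \<alpha> i * \<alpha> j" if "prod_encode (i, j) < N" for i j
  proof -
    \<comment> \<open>Besides the product equation, \<open>X\<close> at \<open>i\<close> removes the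
      mixed term and \<open>Y\<close> at \<open>j\<close> identifies the second factor, so both
      indices must be in range.\<close>
    have "i < N" "j < N"
      using that le_prod_encode_1[of i j] le_prod_encode_2[of j i] by auto
    then show ?thesis
      using eqs[OF that, OF insertI2, OF insertI2, OF insertI2, OF insertI2, OF insertI2, OF insertI1]
        X[of i] Y[of j]
      by (simp add: simps)
  qed
  have pair: "\<alpha> (fst (prod_decode (code_nth N q))) = \<alpha> (snd (prod_decode (code_nth N q)))"
    if "q < N" for q
    using eqs[OF that, OF insertI2, OF insertI2, OF insertI2, OF insertI2, OF insertI2, OF insertI2,
        OF insertI1] by (simp add: simps)
  \<comment> \<open>\<open>5 * i\<close> is the code of \<open>RVar i\<close>, so the variable case
    holds by the choice of assignment.\<close>
  have eval: "ring_eval \<kappa> (\<lambda>i. \<alpha> (5 * i)) t = \<alpha> (ring_code t)" if "ring_code t < N" for t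
    using that
  proof (induction t)
    case (RConst i)
    then show ?case using const[of i] by simp
  next
    case (RAdd s t)
    then show ?case
      using plus[of "ring_code s" "ring_code t"] le_prod_encode_1[of "ring_code s" "ring_code t"]
        le_prod_encode_2[of "ring_code t" "ring_code s"] by simp
  next
    case (RNeg t)
    then show ?case using neg[of "ring_code t"] by simp
  next
    case (RMul s t)
    then show ?case
      using mult[of "ring_code s" "ring_code t"] le_prod_encode_1[of "ring_code s" "ring_code t"]
        le_prod_encode_2[of "ring_code t" "ring_code s"] by simp
  qed simp
  have "ring_eval \<kappa> (\<lambda>i. \<alpha> (5 * i)) s = ring_eval \<kappa> (\<lambda>i. \<alpha> (5 * i)) t" if st: "(s, t) \<in> set S" for s t
  proof -
    obtain q where q: "q < length S" "S ! q = (s, t)" using st by (metis in_set_conv_nth)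
    \<comment> \<open>The bound reaches every position of \<open>S\<close>, so the last equation of
      block \<open>q\<close> compares the two sides of this equation.\<close>
    have "q < N"
      using q(1) length_le_list_encode[of "map (\<lambda>(s, t). prod_encode (ring_code s, ring_code t)) S"]
      by (simp add: N_def system_code_def)
    moreover have "code_nth N q = prod_encode (ring_code s, ring_code t)"
      using q by (simp add: N_def system_code_def code_nth_list_encode)
    ultimately have "\<alpha> (ring_code s) = \<alpha> (ring_code t)" using pair[of q] by simp
    moreover have "prod_encode (ring_code s, ring_code t) < N"
      unfolding N_def system_code_def using st by (intro less_list_encode) force
    then have "ring_code s < N" "ring_code t < N"
      using le_prod_encode_1[of "ring_code s" "ring_code t"]
        le_prod_encode_2[of "ring_code t" "ring_code s"] by auto
    ultimately show ?thesis by (simp add: eval)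
  qed
  then show ?thesis unfolding has_solution_def by blast
qed

lemma (in free_lie_algebra) lie_solution_iff_field_solution:
  assumes "i \<in> I" "j \<in> I" "i \<noteq> j" and "\<mu> c\<^sub>1 = a i" "\<mu> c\<^sub>2 = a j"
    and "N = system_code ring_code S"
  shows "has_solution (lie_eval scale bracket \<kappa> \<mu>) (lie_system c\<^sub>1 c\<^sub>2 N N) \<longleftrightarrow>
    has_solution (ring_eval \<kappa>) S"
proof
  obtain \<phi> :: "'l \<Rightarrow> 'k \<times> 'k"
    where \<phi>: "lie_hom scale bracket affine_scale affine_bracket \<phi>"
      \<comment> \<open>All generators other than \<open>a i\<close> go to \<open>y\<close>; as
        \<open>i \<noteq> j\<close>, this includes \<open>a j\<close>.\<close>
      and gen: "\<forall>k\<in>I. \<phi> (a k) = (if k = i then (1, 0) else (0, 1))"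
    using universal_property[OF lie_algebra_affine, of "\<lambda>k. if k = i then (1, 0) else (0, 1)"]
    by blast
  assume "has_solution (lie_eval scale bracket \<kappa> \<mu>) (lie_system c\<^sub>1 c\<^sub>2 N N)"
  then obtain v where "\<forall>(s, t) \<in> set (lie_system c\<^sub>1 c\<^sub>2 N N).
      lie_eval scale bracket \<kappa> \<mu> v s = lie_eval scale bracket \<kappa> \<mu> v t"
    unfolding has_solution_def by blast
  then have "\<forall>(s, t) \<in> set (lie_system c\<^sub>1 c\<^sub>2 N N).
      lie_eval affine_scale affine_bracket \<kappa> (\<phi> \<circ> \<mu>) (\<phi> \<circ> v) s =
      lie_eval affine_scale affine_bracket \<kappa> (\<phi> \<circ> \<mu>) (\<phi> \<circ> v) t"
    unfolding lie_hom_lie_eval[OF \<phi>, symmetric] by fastforce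
  then have "has_solution (lie_eval affine_scale affine_bracket \<kappa> (\<phi> \<circ> \<mu>))
      (lie_system c\<^sub>1 c\<^sub>2 N N)"
    unfolding has_solution_def by blast
  then show "has_solution (ring_eval \<kappa>) S"
    unfolding assms(6) by (rule affine_solution_imp_field_solution) (use gen assms in auto)
next
  assume "has_solution (ring_eval \<kappa>) S"
  then show "has_solution (lie_eval scale bracket \<kappa> \<mu>) (lie_system c\<^sub>1 c\<^sub>2 N N)"
    unfolding assms(6) by (rule field_solution_imp_lie_solution[OF lie_algebra_axioms])
qed

lemma decidable_vimage:
  assumes "decidable B" "computable1 f" "\<And>x. x \<in> A \<longleftrightarrow> f x \<in> B"
  shows "decidable A"
  using computable_on_comp1[OF assms(1)[unfolded decidable_def],
      of "Suc 0" "\<lambda>xs. f (xs ! 0)"] computable_on_comp1[OF assms(2) computable_on_nth[of 0 "Suc 0"]]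
  unfolding decidable_def assms(3) by (simp add: computable_on_Suc_0_iff)

theorem theorem2:
  fixes scale :: "'k::field \<Rightarrow> 'l::ab_group_add \<Rightarrow> 'l"
    and bracket :: "'l \<Rightarrow> 'l \<Rightarrow> 'l"
    and a :: "nat \<Rightarrow> 'l"
    and n :: nat
    and \<kappa> :: "nat \<Rightarrow> 'k"
    and \<mu> :: "nat \<Rightarrow> 'l"
  assumes "n \<ge> 2"
    and "free_lie_algebra scale bracket {1..n} a"
    and "computable_subring \<kappa>"
    and "computable_lie_subalgebra scale bracket \<kappa> \<mu>"
    and "a ` {1..n} \<subseteq> range \<mu>"
    and "\<not> decidable (diophantine_problem_field \<kappa>)"
  shows "\<not> decidable (diophantine_problem_lie scale bracket \<kappa> \<mu>)"
proof
  assume dec: "decidable (diophantine_problem_lie scale bracket \<kappa> \<mu>)"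
  interpret free_lie_algebra scale bracket "{1..n}" a by fact
  have gens: "1 \<in> {1..n}" "2 \<in> {1..n}" using assms(1) by auto
  then obtain c\<^sub>1 c\<^sub>2 where c: "\<mu> c\<^sub>1 = a 1" "\<mu> c\<^sub>2 = a 2"
    using assms(5) by (metis image_subset_iff rangeE)
  have "N \<in> diophantine_problem_field \<kappa> \<longleftrightarrow>
      system_code lie_code (lie_system c\<^sub>1 c\<^sub>2 N N) \<in> diophantine_problem_lie scale bracket \<kappa> \<mu>" for N
  proof -
    \<comment> \<open>Surjectivity of the coding means that the reduction has no malformed inputs;
      injectivity below turns membership into solvability.\<close>
    obtain S where S: "N = system_code ring_code S"
      using bij_system_code[OF bij_ring_code] by (metis bij_pointE)
    have "N \<in> diophantine_problem_field \<kappa> \<longleftrightarrow> has_solution (ring_eval \<kappa>) S"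
      unfolding diophantine_problem_field_def S
      using bij_system_code[OF bij_ring_code] by (simp add: bij_is_inj inj_image_mem_iff)
    also have "\<dots> \<longleftrightarrow> has_solution (lie_eval scale bracket \<kappa> \<mu>) (lie_system c\<^sub>1 c\<^sub>2 N N)"
      using lie_solution_iff_field_solution[OF gens _ c S] by simp
    also have "\<dots> \<longleftrightarrow>
        system_code lie_code (lie_system c\<^sub>1 c\<^sub>2 N N) \<in> diophantine_problem_lie scale bracket \<kappa> \<mu>"
      unfolding diophantine_problem_lie_def
      using bij_system_code[OF bij_lie_code] by (simp add: bij_is_inj inj_image_mem_iff)
    finally show ?thesis .
  qed
  with dec computable1_lie_system have "decidable (diophantine_problem_field \<kappa>)"
    by (rule decidable_vimage)
  with assms(6) show False ..
qed

end
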